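(* For any subgroups $H,K\leqslant F_A$, $$\sum_{HwK\in H\backslash F_A/K}\mathrm{rrk}(H^w\cap K)\;\leq\;2\,\mathrm{rrk}(H)\,\mathrm{rrk}(K),$$ where the sum runs over a set of representatives $w$ of the double cosets $HwK$ (the sum is independent of the choice of representatives), and the right-hand side may be infinite.
   Context: $H^w=w^{-1}Hw$. For a free group $F$ of rank $n$ (possibly infinite), $\mathrm{rrk}(F)=\max\{0,n-1\}$. *)

theory Defs
  imports "HOL-Algebra.Algebra" "HOL-Library.Extended_Nat"
begin

fun word_eval :: "('a, 'b) monoid_scheme \<Rightarrow> ('a \<times> bool) list \<Rightarrow> 'a" where
  "word_eval G [] = \<one>\<^bsub>G\<^esub>"
| "word_eval G ((b, s) # w) =
     (if s then b else inv\<^bsub>G\<^esub> b) \<otimes>\<^bsub>G\<^esub> word_eval G w"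

fun reduced_word :: "('a \<times> bool) list \<Rightarrow> bool" where
  "reduced_word [] = True"
| "reduced_word [x] = True"
| "reduced_word ((a, s) # (b, t) # w) =
     (\<not> (a = b \<and> s \<noteq> t) \<and> reduced_word ((b, t) # w))"

definition free_basis :: "('a, 'b) monoid_scheme \<Rightarrow> 'a set \<Rightarrow> 'a set \<Rightarrow> bool" where
  "free_basis G H B \<longleftrightarrow>
     B \<subseteq> H \<and> generate G B = H \<and>
     (\<forall>w. set (map fst w) \<subseteq> B \<and> w \<noteq> [] \<and> reduced_word w \<longrightarrow>
          word_eval G w \<noteq> \<one>\<^bsub>G\<^esub>)"

text \<open>Rank of a free subgroup (possibly infinite), and reduced rank
  rrk(H) = max(0, rank(H) - 1) (truncated subtraction on enat, \<infinity> - 1 = \<infinity>).\<close>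

definition free_rank :: "('a, 'b) monoid_scheme \<Rightarrow> 'a set \<Rightarrow> enat" where
  "free_rank G H =
     Inf {r. \<exists>B. free_basis G H B \<and> r = (if finite B then enat (card B) else \<infinity>)}"

definition rrk :: "('a, 'b) monoid_scheme \<Rightarrow> 'a set \<Rightarrow> enat" where
  "rrk G H = free_rank G H - 1"

definition conj_sub :: "('a, 'b) monoid_scheme \<Rightarrow> 'a set \<Rightarrow> 'a \<Rightarrow> 'a set" where
  "conj_sub G H w = (\<lambda>h. inv\<^bsub>G\<^esub> w \<otimes>\<^bsub>G\<^esub> h \<otimes>\<^bsub>G\<^esub> w) ` H"

definition double_coset :: "('a, 'b) monoid_scheme \<Rightarrow> 'a set \<Rightarrow> 'a \<Rightarrow> 'a set \<Rightarrow> 'a set" where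
  "double_coset G H w K = H <#>\<^bsub>G\<^esub> {w} <#>\<^bsub>G\<^esub> K"

definition esum :: "('c \<Rightarrow> enat) \<Rightarrow> 'c set \<Rightarrow> enat" where
  "esum f W = (SUP F \<in> {F. finite F \<and> F \<subseteq> W}. sum f F)"

end

theory Submission
  imports Defs
begin

text \<open>Let \<open>F\<^sub>A\<close> act on the right cosets of \<open>H\<close>. A subgroup of reduced rank \<open>r\<close> is the stabiliser of a
  vertex in a connected Schreier graph in which \<open>r\<close> is the maximum, over all finite subgraphs, of the
  number of edges minus the number of vertices. The vertices \<open>(Hw, K)\<close> of the product of the Schreier
  graphs of \<open>H\<close> and \<open>K\<close> have stabilisers \<open>H\<^sup>w \<inter> K\<close> and lie in different components for different
  double cosets, so the left-hand side is the supremum of edges minus vertices over the finite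
  subgraphs of the product. Pruning leaves, one may assume that all degrees are at least two. Then twice the number of
  edges minus vertices is the sum of \<open>deg - 2\<close> over the vertices, and at a vertex \<open>(x, y)\<close> this is at
  most \<open>(deg x - 2) * (deg y - 2)\<close>, the degrees being taken in the two projections. Summing over
  all pairs \<open>(x, y)\<close> gives the factor 2.\<close>

section \<open>Finite subgraphs of labelled graphs\<close>

text \<open>A set \<open>E\<close> of pairs \<open>(x, a)\<close> is a labelled directed graph, where \<open>(x, a)\<close> is an edge from
  \<open>x\<close> to \<open>f x a\<close>. The link of \<open>v\<close> consists of the labels of the half-edges at \<open>v\<close>, so a loop
  contributes two elements.\<close>

definition verts :: "('v \<Rightarrow> 'l \<Rightarrow> 'v) \<Rightarrow> ('v \<times> 'l) set \<Rightarrow> 'v set" where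
  "verts f E = fst ` E \<union> (\<lambda>(x, a). f x a) ` E"

definition link :: "('v \<Rightarrow> 'l \<Rightarrow> 'v) \<Rightarrow> ('v \<times> 'l) set \<Rightarrow> 'v \<Rightarrow> ('l \<times> bool) set" where
  "link f E v = {(a, s). if s then (v, a) \<in> E else \<exists>x. (x, a) \<in> E \<and> f x a = v}"

text \<open>Edges leaving a vertex have distinct labels because an edge is the pair of its source
  and its label; this is the same condition for edges entering a vertex. Both together make the
  graph folded, so that \<open>card (link f E v)\<close> is the degree of \<open>v\<close>.\<close>

definition codet :: "('v \<Rightarrow> 'l \<Rightarrow> 'v) \<Rightarrow> ('v \<times> 'l) set \<Rightarrow> bool" where
  "codet f E \<longleftrightarrow> (\<forall>x y a. (x, a) \<in> E \<and> (y, a) \<in> E \<and> f x a = f y a \<longrightarrow> x = y)"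

lemma codetD: "codet f E \<Longrightarrow> (x, a) \<in> E \<Longrightarrow> (y, a) \<in> E \<Longrightarrow> f x a = f y a \<Longrightarrow> x = y"
  unfolding codet_def by blast

lemma finite_verts: "finite E \<Longrightarrow> finite (verts f E)"
  by (simp add: verts_def)

lemma finite_link:
  assumes "finite E" shows "finite (link f E v)"
proof (rule finite_subset)
  show "link f E v \<subseteq> snd ` E \<times> UNIV"
    by (force simp: link_def split: if_splits)
qed (use assms in simp)

lemma verts_Un: "verts f (E \<union> E') = verts f E \<union> verts f E'"
  by (auto simp: verts_def)

text \<open>Each edge splits into two half-edges, \<open>True\<close> at its source and
  \<open>False\<close> at its target, and \<open>codet\<close> recovers the edge from the end
  vertex, label and sign of a half-edge.\<close>

lemma handshake:
  assumes "finite E" and "codet f E"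
  shows "(\<Sum>v\<in>verts f E. card (link f E v)) = 2 * card E"
proof -
  let ?h = "\<lambda>((x, a), s). (if s then x else f x a, (a, s))"
  have "bij_betw ?h (E \<times> UNIV) (Sigma (verts f E) (link f E))"
    unfolding bij_betw_def
  proof
    show "inj_on ?h (E \<times> UNIV)"
    proof (rule inj_onI)
      fix p q assume "p \<in> E \<times> UNIV" "q \<in> E \<times> UNIV" and eq: "?h p = ?h q"
      then obtain x a s y b t where pq: "p = ((x, a), s)" "q = ((y, b), t)" "(x, a) \<in> E" "(y, b) \<in> E"
        by auto
      then have "a = b" "s = t" "s \<Longrightarrow> x = y" "\<not> s \<Longrightarrow> f x a = f y a" using eq by auto
      then show "p = q" using codetD[OF assms(2), of x a y] pq by (cases s) simp_all
    qed
    show "?h ` (E \<times> UNIV) = Sigma (verts f E) (link f E)"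
    proof (intro equalityI subsetI)
      fix p assume "p \<in> ?h ` (E \<times> UNIV)"
      then obtain x a s where "(x, a) \<in> E" "p = ?h ((x, a), s)" by auto
      then show "p \<in> Sigma (verts f E) (link f E)"
        by (cases s) (force simp: verts_def link_def)+
    next
      fix p assume "p \<in> Sigma (verts f E) (link f E)"
      then obtain v a s where p: "p = (v, (a, s))" "(a, s) \<in> link f E v" by auto
      show "p \<in> ?h ` (E \<times> UNIV)"
      proof (cases s)
        case True
        then have "((v, a), True) \<in> E \<times> UNIV" "p = ?h ((v, a), True)"
          using p by (auto simp: link_def)
        then show ?thesis by blast
      next
        case False
        then obtain x where "(x, a) \<in> E" "f x a = v" using p by (auto simp: link_def)
        then have "((x, a), False) \<in> E \<times> UNIV" "p = ?h ((x, a), False)"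
          using p False by auto
        then show ?thesis by blast
      qed
    qed
  qed
  then have "card (Sigma (verts f E) (link f E)) = card (E \<times> (UNIV :: bool set))"
    by (rule bij_betw_same_card[symmetric])
  then show ?thesis
    using assms(1) by (simp add: finite_verts finite_link card_cartesian_product)
qed

text \<open>Subtract two per vertex from \<open>handshake\<close>. Degrees of at least two keep the
  truncated subtractions exact on both sides.\<close>

lemma excess_sum:
  assumes "finite E" "codet f E" "\<And>v. v \<in> verts f E \<Longrightarrow> 2 \<le> card (link f E v)"
  shows "(\<Sum>v\<in>verts f E. card (link f E v) - 2) = 2 * (card E - card (verts f E))"
proof -
  have "(\<Sum>v\<in>verts f E. card (link f E v)) =
      (\<Sum>v\<in>verts f E. (card (link f E v) - 2) + 2)"
    using assms(3) by (intro sum.cong refl le_add_diff_inverse2[symmetric])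
  also have "\<dots> = (\<Sum>v\<in>verts f E. card (link f E v) - 2) + 2 * card (verts f E)"
    by (simp only: sum.distrib sum_constant) simp
  finally have "2 * card E = (\<Sum>v\<in>verts f E. card (link f E v) - 2) + 2 * card (verts f E)"
    using handshake[OF assms(1,2)] by simp
  then show "(\<Sum>v\<in>verts f E. card (link f E v) - 2) = 2 * (card E - card (verts f E))" by simp
qed

text \<open>Deleting a leaf together with its edge does not change \<open>card E - card (verts f E)\<close>.\<close>

lemma prune_leaves:
  assumes "finite E" "codet f E" "card (verts f E) + m \<le> card E"
  shows "\<exists>E'\<subseteq>E. card (verts f E') + m \<le> card E' \<and> (\<forall>v\<in>verts f E'. 2 \<le> card (link f E' v))"
  using assms
proof (induction "card E" arbitrary: E rule: less_induct)
  case less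
  show ?case
  proof (cases "\<forall>v\<in>verts f E. 2 \<le> card (link f E v)")
    case True
    then show ?thesis using less.prems by blast
  next
    case False
    then obtain v where v: "v \<in> verts f E" "card (link f E v) < 2" by auto
    from v(1) obtain e where e: "e \<in> E" "fst e = v \<or> f (fst e) (snd e) = v"
      unfolding verts_def case_prod_beta by blast
    have uniq: "k = l" if "k \<in> link f E v" "l \<in> link f E v" for k l
    proof (rule ccontr)
      assume "k \<noteq> l"
      then have "card {k, l} = 2" by simp
      moreover have "card {k, l} \<le> card (link f E v)"
        using that finite_link[OF less.prems(1)] by (intro card_mono) auto
      ultimately show False using v(2) by simp
    qed
    let ?E = "E - {e}"
    \<comment> \<open>The link of \<open>v\<close> has at most one element, so a second edge at
      \<open>v\<close> would share label and direction with \<open>e\<close>; it would then equal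
      \<open>e\<close>, by \<open>codet\<close> if both edges end at \<open>v\<close>. Hence
      deleting \<open>e\<close> loses one edge and at least one vertex.\<close>
    have "v \<notin> verts f ?E"
    proof
      assume "v \<in> verts f ?E"
      then obtain e' where e': "e' \<in> E" "e' \<noteq> e" "fst e' = v \<or> f (fst e') (snd e') = v"
        unfolding verts_def case_prod_beta by blast
      define k where "k = (\<lambda>e::'a \<times> 'b. (snd e, fst e = v))"
      have "k e \<in> link f E v" if "e \<in> E" "fst e = v \<or> f (fst e) (snd e) = v" for e
        using that by (cases e) (auto simp: k_def link_def)
      then have k: "k e \<in> link f E v" "k e' \<in> link f E v" using e e' by blast+
      from uniq[OF k] have eq: "snd e = snd e'" "fst e = v \<longleftrightarrow> fst e' = v" by (auto simp: k_def)
      then have "fst e \<noteq> v" "fst e' \<noteq> v"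
        using e'(2) by (auto simp: prod_eq_iff)
      then have "f (fst e) (snd e) = f (fst e') (snd e)" using e e' eq by auto
      then have "fst e = fst e'"
        using codetD[OF less.prems(2), of "fst e" "snd e" "fst e'"] e(1) e'(1) eq(1)
        by (metis prod.collapse)
      then show False using eq(1) e'(2) by (simp add: prod_eq_iff)
    qed
    then have "verts f ?E \<subseteq> verts f E - {v}" by (auto simp: verts_def)
    then have "card (verts f ?E) \<le> card (verts f E - {v})"
      by (intro card_mono) (simp_all add: finite_verts less.prems(1))
    moreover have "card (verts f E - {v}) < card (verts f E)"
      by (intro psubset_card_mono) (use v(1) in \<open>auto simp: finite_verts less.prems(1)\<close>)
    moreover have "Suc (card ?E) = card E"
      using less.prems(1) e(1) by (rule card_Suc_Diff1)
    ultimately have "card (verts f ?E) + m \<le> card ?E" "card ?E < card E"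
      using less.prems(3) by linarith+
    moreover have "finite ?E" "codet f ?E"
      using less.prems by (auto simp: codet_def)
    ultimately obtain E' where "E' \<subseteq> ?E" "card (verts f E') + m \<le> card E'"
        "\<forall>v\<in>verts f E'. 2 \<le> card (link f E' v)"
      using less.hyps by meson
    then show ?thesis by blast
  qed
qed

text \<open>A link in the product is contained in the links of both projections, so its excess
  \<open>d\<close> over two satisfies \<open>d \<le> d * d\<close>, which is at most the product of
  the two projected excesses. The sum over all pairs of projected vertices factors. With
  \<open>X\<close>, \<open>Y\<close>, \<open>Z\<close> for edges minus vertices in the product and
  the two projections, \<open>excess_sum\<close> turns this into
  \<open>2 * X \<le> 2 * Y * (2 * Z)\<close>.\<close>

lemma product_graph_bound:
  fixes f :: "'v \<Rightarrow> 'l \<Rightarrow> 'v" and g :: "'u \<Rightarrow> 'l \<Rightarrow> 'u" and E :: "(('v \<times> 'u) \<times> 'l) set"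
  defines "fg \<equiv> \<lambda>p a. (f (fst p) a, g (snd p) a)"
    and "E\<^sub>1 \<equiv> map_prod fst id ` E" and "E\<^sub>2 \<equiv> map_prod snd id ` E"
  assumes fin: "finite E" and det: "codet fg E" "codet f E\<^sub>1" "codet g E\<^sub>2"
    and deg: "\<And>v. v \<in> verts fg E \<Longrightarrow> 2 \<le> card (link fg E v)"
  shows "card E - card (verts fg E) \<le>
    2 * (card E\<^sub>1 - card (verts f E\<^sub>1)) * (card E\<^sub>2 - card (verts g E\<^sub>2))"
proof -
  have fin12: "finite E\<^sub>1" "finite E\<^sub>2" using fin by (simp_all add: E\<^sub>1_def E\<^sub>2_def)
  have V1: "verts f E\<^sub>1 = fst ` verts fg E"
    by (force simp: verts_def E\<^sub>1_def fg_def image_Un image_image case_prod_beta)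
  have V2: "verts g E\<^sub>2 = snd ` verts fg E"
    by (force simp: verts_def E\<^sub>2_def fg_def image_Un image_image case_prod_beta)
  have sub: "link fg E p \<subseteq> link f E\<^sub>1 (fst p)" "link fg E p \<subseteq> link g E\<^sub>2 (snd p)" for p
    by (force simp: link_def E\<^sub>1_def E\<^sub>2_def fg_def split: if_splits)+
  have le: "card (link fg E p) \<le> card (link f E\<^sub>1 (fst p))"
    "card (link fg E p) \<le> card (link g E\<^sub>2 (snd p))" for p
    using card_mono[OF finite_link[OF fin12(1)] sub(1)] card_mono[OF finite_link[OF fin12(2)] sub(2)]
    by auto
  have deg1: "2 \<le> card (link f E\<^sub>1 x)" if "x \<in> verts f E\<^sub>1" for x
    using that deg le(1) order_trans unfolding V1 by blast
  have deg2: "2 \<le> card (link g E\<^sub>2 x)" if "x \<in> verts g E\<^sub>2" for x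
    using that deg le(2) order_trans unfolding V2 by blast
  have "2 * (card E - card (verts fg E)) = (\<Sum>p\<in>verts fg E. card (link fg E p) - 2)"
    using excess_sum[OF fin det(1) deg] by simp
  also have "\<dots> \<le> (\<Sum>p\<in>verts fg E.
      (card (link f E\<^sub>1 (fst p)) - 2) * (card (link g E\<^sub>2 (snd p)) - 2))"
  proof (rule sum_mono)
    fix p
    let ?d = "card (link fg E p) - 2"
    have "?d \<le> ?d * ?d" by (rule le_square)
    also have "\<dots> \<le> (card (link f E\<^sub>1 (fst p)) - 2) * (card (link g E\<^sub>2 (snd p)) - 2)"
      using le[of p] by (intro mult_le_mono) auto
    finally show "?d \<le> (card (link f E\<^sub>1 (fst p)) - 2) * (card (link g E\<^sub>2 (snd p)) - 2)" .
  qed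
  also have "\<dots> \<le> (\<Sum>p\<in>verts f E\<^sub>1 \<times> verts g E\<^sub>2.
      (card (link f E\<^sub>1 (fst p)) - 2) * (card (link g E\<^sub>2 (snd p)) - 2))"
  proof (rule sum_mono2)
    show "verts fg E \<subseteq> verts f E\<^sub>1 \<times> verts g E\<^sub>2"
      unfolding V1 V2 by force
  qed (simp_all add: fin12 finite_verts)
  also have "\<dots> = (\<Sum>x\<in>verts f E\<^sub>1. card (link f E\<^sub>1 x) - 2) *
      (\<Sum>y\<in>verts g E\<^sub>2. card (link g E\<^sub>2 y) - 2)"
    by (simp add: sum_product sum.cartesian_product case_prod_beta)
  also have "\<dots> = 2 * (card E\<^sub>1 - card (verts f E\<^sub>1)) * (2 * (card E\<^sub>2 - card (verts g E\<^sub>2)))"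
    using excess_sum[OF fin12(1) det(2) deg1] excess_sum[OF fin12(2) det(3) deg2] by simp
  finally show ?thesis by (simp add: algebra_simps)
qed

section \<open>Universal property of a free basis\<close>

context group
begin

lemma word_eval_closed: "fst ` set w \<subseteq> carrier G \<Longrightarrow> word_eval G w \<in> carrier G"
  by (induction w) auto

lemma word_eval_append:
  "fst ` set u \<subseteq> carrier G \<Longrightarrow> fst ` set v \<subseteq> carrier G \<Longrightarrow>
    word_eval G (u @ v) = word_eval G u \<otimes> word_eval G v"
  by (induction u) (auto simp: word_eval_closed m_assoc)

lemma ex_inverse_word:
  "fst ` set w \<subseteq> carrier G \<Longrightarrow>
    \<exists>v. fst ` set v = fst ` set w \<and> word_eval G v = inv (word_eval G w)"
proof (induction w)
  case (Cons l w)
  then obtain v where v: "fst ` set v = fst ` set w" "word_eval G v = inv (word_eval G w)" by auto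
  obtain b s where l: "l = (b, s)" by force
  have "word_eval G (v @ [(b, \<not> s)]) = inv (word_eval G (l # w))"
    using Cons.prems v by (auto simp: l word_eval_append word_eval_closed inv_mult_group)
  then show ?case using v(1) l by (intro exI[of _ "v @ [(b, \<not> s)]"]) auto
qed auto

lemma generate_word_eval:
  assumes "A \<subseteq> carrier G" and "g \<in> generate G A"
  shows "\<exists>w. fst ` set w \<subseteq> A \<and> word_eval G w = g"
  using assms(2)
proof (induction rule: generate.induct)
  case one
  then show ?case by (intro exI[of _ "[]"]) simp
next
  case (incl h)
  then show ?case using assms(1) by (intro exI[of _ "[(h, True)]"]) auto
next
  case (inv h)
  then show ?case using assms(1) by (intro exI[of _ "[(h, False)]"]) auto
next
  case (eng h1 h2)
  then obtain u v where "fst ` set u \<subseteq> A" "word_eval G u = h1" "fst ` set v \<subseteq> A" "word_eval G v = h2"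
    by blast
  then show ?case using assms(1) by (intro exI[of _ "u @ v"]) (auto simp: word_eval_append)
qed

end

lemma not_reduced_split:
  "\<not> reduced_word w \<Longrightarrow> \<exists>u a s v. w = u @ (a, s) # (a, \<not> s) # v"
proof (induction w rule: reduced_word.induct)
  case (3 a s b t w)
  show ?case
  proof (cases "a = b \<and> s \<noteq> t")
    case True
    then show ?thesis by (intro exI[of _ "[]"]) auto
  next
    case False
    then obtain u c r v where "(b, t) # w = u @ (c, r) # (c, \<not> r) # v" using 3 by auto
    then show ?thesis by (intro exI[of _ "(a, s) # u"]) auto
  qed
qed auto

text \<open>Permutations of \<open>S\<close> assigned to the basis extend to a right action of the
  whole group. Words act letter by letter. A nonempty word with value one is not reduced, and
  deleting a cancelling pair changes neither its value nor its action, so by induction it acts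
  trivially; hence the action of a word depends on its value only.\<close>

lemma (in group) free_basis_action:
  assumes A: "free_basis G (carrier G) A" and bij: "\<And>a. a \<in> A \<Longrightarrow> bij_betw (f a) S S"
  shows "\<exists>\<rho>. (\<forall>s\<in>S. \<rho> \<one> s = s) \<and> (\<forall>a\<in>A. \<forall>s\<in>S. \<rho> a s = f a s) \<and>
    (\<forall>g\<in>carrier G. \<forall>h\<in>carrier G. \<forall>s\<in>S. \<rho> (g \<otimes> h) s = \<rho> h (\<rho> g s))"
proof -
  have AG: "A \<subseteq> carrier G" "generate G A = carrier G"
    and free: "\<And>w. fst ` set w \<subseteq> A \<Longrightarrow> w \<noteq> [] \<Longrightarrow> reduced_word w \<Longrightarrow> word_eval G w \<noteq> \<one>"
    using A by (auto simp: free_basis_def)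
  define st where "st = (\<lambda>l s. if snd l then f (fst l) s else inv_into S (f (fst l)) s)"
  define run where "run = (\<lambda>w s. fold st w s)"
  have run_append: "run (u @ v) s = run v (run u s)" for u v s by (simp add: run_def)
  have st: "st (a, b) s \<in> S \<and> st (a, \<not> b) (st (a, b) s) = s" if "a \<in> A" "s \<in> S" for a b s
  proof (cases b)
    case True
    then show ?thesis using bij[OF that(1)] that
      by (auto simp: st_def bij_betw_apply bij_betw_inv_into_left)
  next
    case False
    then show ?thesis using bij[OF that(1)] that
      by (auto simp: st_def bij_betw_inv_into_right bij_betw_apply[OF bij_betw_inv_into])
  qed
  have run_in: "run w s \<in> S" if "fst ` set w \<subseteq> A" "s \<in> S" for w s
    using that
  proof (induction w arbitrary: s)
    case (Cons l w)
    then have "st l s \<in> S" using st[of "fst l" s "snd l"] by auto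
    then show ?case using Cons by (simp add: run_def)
  qed (simp add: run_def)
  have trivial: "run w s = s" if "fst ` set w \<subseteq> A" "word_eval G w = \<one>" "s \<in> S" for w s
    using that
  proof (induction "length w" arbitrary: w rule: less_induct)
    case less
    show ?case
    proof (cases "w = []")
      case True
      then show ?thesis by (simp add: run_def)
    next
      case False
      then have "\<not> reduced_word w" using free less.prems by blast
      then obtain u a b v where w: "w = u @ (a, b) # (a, \<not> b) # v"
        using not_reduced_split by metis
      have sub: "fst ` set u \<subseteq> A" "fst ` set v \<subseteq> A" "a \<in> A" using less.prems(1) w by auto
      have subG: "fst ` set u \<subseteq> carrier G" "fst ` set v \<subseteq> carrier G" "a \<in> carrier G"
        using sub AG(1) by auto
      have "word_eval G ((a, b) # (a, \<not> b) # v) = word_eval G v"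
        using subG by (cases b) (simp_all add: word_eval_closed inv_solve_left flip: m_assoc)
      then have "word_eval G w = word_eval G (u @ v)"
        using subG by (simp add: w word_eval_append del: word_eval.simps)
      then have "run (u @ v) s = s"
        using less.prems sub by (intro less.hyps) (auto simp: w)
      moreover have "run w s = run (u @ v) s"
        using st[OF sub(3) run_in[OF sub(1) less.prems(3)], of b]
        by (simp add: w run_append) (simp add: run_def)
      ultimately show ?thesis by simp
    qed
  qed
  have run_cong: "run w s = run w' s"
    if w: "fst ` set w \<subseteq> A" "fst ` set w' \<subseteq> A" "word_eval G w = word_eval G w'" "s \<in> S" for w w' s
  proof -
    have wG: "fst ` set w \<subseteq> carrier G" "fst ` set w' \<subseteq> carrier G" using w(1,2) AG(1) by auto
    obtain v where v: "fst ` set v = fst ` set w'" "word_eval G v = inv (word_eval G w')"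
      using ex_inverse_word[OF wG(2)] by blast
    have vA: "fst ` set v \<subseteq> A" "fst ` set v \<subseteq> carrier G" using v(1) w(2) wG(2) by simp_all
    \<comment> \<open>Both \<open>v @ w'\<close> and \<open>w @ v\<close> have value one. Running
      \<open>w\<close>, \<open>v\<close>, \<open>w'\<close> in turn from \<open>s\<close> therefore
      ends at \<open>run w s\<close> by the first fact and at \<open>run w' s\<close> by the
      second.\<close>
    have "run (v @ w') (run w s) = run w s"
      by (rule trivial) (use v(2) vA w wG run_in in
        \<open>simp_all add: word_eval_append word_eval_closed image_Un\<close>)
    moreover have "run (w @ v) s = s"
      by (rule trivial) (use v(2) vA w wG in
        \<open>simp_all add: word_eval_append word_eval_closed image_Un\<close>)
    ultimately show ?thesis by (simp add: run_append)
  qed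
  define wd where "wd = (\<lambda>g. SOME w. fst ` set w \<subseteq> A \<and> word_eval G w = g)"
  have wd: "fst ` set (wd g) \<subseteq> A" "word_eval G (wd g) = g" if "g \<in> carrier G" for g
    using someI_ex[OF generate_word_eval[OF AG(1)], of g] that unfolding wd_def AG(2) by auto
  have run_wd: "run (wd (word_eval G w)) s = run w s" if "fst ` set w \<subseteq> A" "s \<in> S" for w s
    using that AG(1) by (intro run_cong wd) (auto simp: word_eval_closed)
  have "run (wd \<one>) s = s" if "s \<in> S" for s
    using wd[of \<one>] trivial that by auto
  moreover have "run (wd a) s = f a s" if "a \<in> A" "s \<in> S" for a s
    using run_wd[of "[(a, True)]" s] AG(1) that by (auto simp: run_def st_def)
  moreover have "run (wd (g \<otimes> h)) s = run (wd h) (run (wd g) s)"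
    if gh: "g \<in> carrier G" "h \<in> carrier G" "s \<in> S" for g h s
  proof -
    have "word_eval G (wd g @ wd h) = g \<otimes> h"
      using wd[OF gh(1)] wd[OF gh(2)] AG(1) by (subst word_eval_append) auto
    moreover have "fst ` set (wd g @ wd h) \<subseteq> A" using wd(1)[OF gh(1)] wd(1)[OF gh(2)] by auto
    ultimately show ?thesis
      using run_wd[of "wd g @ wd h" s] gh(3) by (simp add: run_append)
  qed
  ultimately show ?thesis by (intro exI[of _ "\<lambda>g. run (wd g)"]) simp
qed

section \<open>Schreier graphs of actions of a free group\<close>

text \<open>The Schreier graph of the action is \<open>\<Omega> \<times> A\<close> with
  \<open>act\<close> as edge function. Its components are spanned by the orbits, so finite subsets
  of \<open>orb x \<times> A\<close> are the finite subgraphs of the component of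
  \<open>x\<close>.\<close>

locale free_group_action = group G for G (structure) +
  fixes A :: "'a set" and \<Omega> :: "'v set" and act :: "'v \<Rightarrow> 'a \<Rightarrow> 'v"  (infixl \<open>\<triangleright>\<close> 70)
  assumes basis: "free_basis G (carrier G) A"
    and act_closed: "x \<in> \<Omega> \<Longrightarrow> g \<in> carrier G \<Longrightarrow> x \<triangleright> g \<in> \<Omega>"
    and act_one: "x \<in> \<Omega> \<Longrightarrow> x \<triangleright> \<one> = x"
    and act_mult: "x \<in> \<Omega> \<Longrightarrow> g \<in> carrier G \<Longrightarrow> h \<in> carrier G \<Longrightarrow> x \<triangleright> (g \<otimes> h) = x \<triangleright> g \<triangleright> h"
begin

definition orb :: "'v \<Rightarrow> 'v set" where "orb x = (\<lambda>g. x \<triangleright> g) ` carrier G"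

definition stab :: "'v \<Rightarrow> 'a set" where "stab x = {g \<in> carrier G. x \<triangleright> g = x}"

lemma basis_carrier: "a \<in> A \<Longrightarrow> a \<in> carrier G"
  using basis by (auto simp: free_basis_def)

lemma basis_induct [consumes 1, case_names one incl inv mult]:
  assumes "g \<in> carrier G" and "P \<one>" and "\<And>a. a \<in> A \<Longrightarrow> P a" and "\<And>a. a \<in> A \<Longrightarrow> P (inv a)"
    and "\<And>g h. g \<in> carrier G \<Longrightarrow> h \<in> carrier G \<Longrightarrow> P g \<Longrightarrow> P h \<Longrightarrow> P (g \<otimes> h)"
  shows "P g"
proof -
  have gen: "generate G A = carrier G" using basis by (simp add: free_basis_def)
  then have "g \<in> generate G A" using assms(1) by simp
  then show ?thesis
    by (induction rule: generate.induct) (use assms(2-5) gen in auto)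
qed

lemma act_inv_cancel [simp]:
  assumes "x \<in> \<Omega>" "g \<in> carrier G"
  shows "x \<triangleright> g \<triangleright> inv g = x" and "x \<triangleright> inv g \<triangleright> g = x"
  using assms act_mult[of x g "inv g"] act_mult[of x "inv g" g] by (auto simp: act_one)

lemma codet_act: "E \<subseteq> \<Omega> \<times> A \<Longrightarrow> codet (\<triangleright>) E"
  unfolding codet_def using act_inv_cancel(1) basis_carrier by (metis SigmaD1 SigmaD2 subsetD)

lemma orb_closed: "x \<in> \<Omega> \<Longrightarrow> y \<in> orb x \<Longrightarrow> g \<in> carrier G \<Longrightarrow> y \<triangleright> g \<in> orb x"
  by (auto simp: orb_def act_mult[symmetric])

lemma orb_subset: "x \<in> \<Omega> \<Longrightarrow> orb x \<subseteq> \<Omega>"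
  by (auto simp: orb_def act_closed)

lemma orb_refl: "x \<in> \<Omega> \<Longrightarrow> x \<in> orb x"
  using act_one[of x] by (force simp: orb_def)

lemma verts_orb: "x \<in> \<Omega> \<Longrightarrow> E \<subseteq> orb x \<times> A \<Longrightarrow> verts (\<triangleright>) E \<subseteq> orb x"
  using orb_closed basis_carrier by (force simp: verts_def)

lemma subgroup_stab: "x \<in> \<Omega> \<Longrightarrow> subgroup (stab x) G"
proof (rule subgroupI)
  assume x: "x \<in> \<Omega>"
  show "stab x \<noteq> {}" using x act_one by (auto simp: stab_def)
  show "inv g \<in> stab x" if "g \<in> stab x" for g
    using act_inv_cancel(1)[OF x, of g] that by (auto simp: stab_def)
  show "g \<otimes> h \<in> stab x" if "g \<in> stab x" "h \<in> stab x" for g h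
    using x that by (auto simp: stab_def act_mult)
qed (auto simp: stab_def)

text \<open>\<open>c x g\<close> is the parity of the number of times the path from \<open>x\<close> spelled by \<open>g\<close> crosses an
  edge of \<open>Q\<close>.\<close>

lemma crossing_parity:
  obtains c :: "'v \<Rightarrow> 'a \<Rightarrow> bool"
  where "\<And>x g h. x \<in> \<Omega> \<Longrightarrow> g \<in> carrier G \<Longrightarrow> h \<in> carrier G \<Longrightarrow> c x (g \<otimes> h) = (c x g \<noteq> c (x \<triangleright> g) h)"
    and "\<And>x a. x \<in> \<Omega> \<Longrightarrow> a \<in> A \<Longrightarrow> c x a \<longleftrightarrow> (x, a) \<in> Q"
proof -
  \<comment> \<open>A two-sheeted cover of the Schreier graph: the generator \<open>a\<close> moves
    along the edge \<open>(x, a)\<close> and changes the sheet exactly if that edge lies in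
    \<open>Q\<close>. The universal property extends this to all of \<open>G\<close>, and
    \<open>c x g\<close> is the sheet reached from \<open>False\<close>.\<close>
  define f where "f = (\<lambda>a (x, b). (x \<triangleright> a, b \<noteq> ((x, a) \<in> Q)))"
  define f' where "f' = (\<lambda>a (x, b). (x \<triangleright> inv a, b \<noteq> ((x \<triangleright> inv a, a) \<in> Q)))"
  have bij: "bij_betw (f a) (\<Omega> \<times> UNIV) (\<Omega> \<times> UNIV)" if "a \<in> A" for a
    using basis_carrier[OF that]
    by (intro bij_betwI[where g = "f' a"]) (auto simp: f_def f'_def act_closed)
  obtain \<rho> where
    "\<forall>s\<in>\<Omega> \<times> UNIV. \<rho> \<one> s = s" "\<forall>a\<in>A. \<forall>s\<in>\<Omega> \<times> UNIV. \<rho> a s = f a s"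
    "\<forall>g\<in>carrier G. \<forall>h\<in>carrier G. \<forall>s\<in>\<Omega> \<times> UNIV. \<rho> (g \<otimes> h) s = \<rho> h (\<rho> g s)"
    using free_basis_action[OF basis, of f, OF bij] by blast
  note \<rho> = this[rule_format]
  define c where "c = (\<lambda>x g. snd (\<rho> g (x, False)))"
  \<comment> \<open>The action commutes with exchanging the sheets, so the change of sheet does not
    depend on the starting bit. This yields the cocycle rule for \<open>c\<close>.\<close>
  have \<rho>c: "\<forall>x\<in>\<Omega>. \<forall>b. \<rho> g (x, b) = (x \<triangleright> g, b \<noteq> c x g)" if "g \<in> carrier G" for g
    using that
  proof (induction rule: basis_induct)
    case one
    then show ?case by (simp add: \<rho> c_def act_one)
  next
    case (incl a)
    then show ?case by (simp add: \<rho> c_def f_def)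
  next
    case (inv a)
    have "\<rho> (inv a) (x, b) = (x \<triangleright> inv a, b \<noteq> ((x \<triangleright> inv a, a) \<in> Q))" if "x \<in> \<Omega>" for x b
    proof -
      let ?s = "(x \<triangleright> inv a, b \<noteq> ((x \<triangleright> inv a, a) \<in> Q))"
      have s: "?s \<in> \<Omega> \<times> UNIV" and a: "a \<in> carrier G"
        using that inv basis_carrier act_closed by auto
      have "\<rho> a ?s = (x, b)" using \<rho>(2)[OF inv s] a that by (auto simp: f_def)
      then show ?thesis using \<rho>(3)[OF a inv_closed[OF a] s] \<rho>(1)[OF s] a by simp
    qed
    then show ?case by (simp add: c_def)
  next
    case (mult g h)
    then have "\<rho> (g \<otimes> h) (x, b) = (x \<triangleright> (g \<otimes> h), (b \<noteq> c x g) \<noteq> c (x \<triangleright> g) h)" if "x \<in> \<Omega>" for x b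
      using that \<rho>(3)[of g h "(x, b)"] by (auto simp: act_closed act_mult)
    then show ?case by (auto simp: c_def)
  qed
  show thesis
  proof (rule that[of c])
    fix x g h assume "x \<in> \<Omega>" "g \<in> carrier G" "h \<in> carrier G"
    then show "c x (g \<otimes> h) = (c x g \<noteq> c (x \<triangleright> g) h)"
      using \<rho>(3)[of g h "(x, False)"] \<rho>c[of g] \<rho>c[of h] \<rho>c[of "g \<otimes> h"] by (simp add: act_closed)
  next
    fix x a assume "x \<in> \<Omega>" "a \<in> A"
    then show "c x a \<longleftrightarrow> (x, a) \<in> Q" by (simp add: c_def \<rho> f_def)
  qed
qed

text \<open>A set \<open>Q\<close> of edges is recovered from its crossing parities along the generators and along
  fixed paths from \<open>x\<close> to the vertices, the latter only up to a common change of sign.\<close>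

lemma orbit_subgraph_bound:
  assumes x: "x \<in> \<Omega>" and S: "finite S" "generate G S = stab x"
    and E: "finite E" "E \<noteq> {}" "E \<subseteq> orb x \<times> A"
  shows "card E + 1 \<le> card (verts (\<triangleright>) E) + card S"
proof -
  let ?V = "verts (\<triangleright>) E"
  define P where "P = (\<lambda>Q c. (\<forall>x\<in>\<Omega>. \<forall>g\<in>carrier G. \<forall>h\<in>carrier G.
      c x (g \<otimes> h) = (c x g \<noteq> c (x \<triangleright> g) h)) \<and> (\<forall>x\<in>\<Omega>. \<forall>a\<in>A. c x a \<longleftrightarrow> (x, a) \<in> Q))"
  have "\<exists>c. P Q c" for Q
  proof (rule crossing_parity[of Q])
    fix c
    assume "\<And>x g h. x \<in> \<Omega> \<Longrightarrow> g \<in> carrier G \<Longrightarrow> h \<in> carrier G \<Longrightarrow> c x (g \<otimes> h) = (c x g \<noteq> c (x \<triangleright> g) h)"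
      and "\<And>x a. x \<in> \<Omega> \<Longrightarrow> a \<in> A \<Longrightarrow> c x a \<longleftrightarrow> (x, a) \<in> Q"
    then show "\<exists>c. P Q c" unfolding P_def by (intro exI[of _ c]) simp
  qed
  then have "\<exists>c. \<forall>Q. P Q (c Q)" by (intro choice) simp
  then obtain c where "\<And>Q. P Q (c Q)" by blast
  then have c_mult: "\<And>Q x g h. x \<in> \<Omega> \<Longrightarrow> g \<in> carrier G \<Longrightarrow> h \<in> carrier G \<Longrightarrow>
      c Q x (g \<otimes> h) = (c Q x g \<noteq> c Q (x \<triangleright> g) h)"
    and c_basis: "\<And>Q x a. x \<in> \<Omega> \<Longrightarrow> a \<in> A \<Longrightarrow> c Q x a \<longleftrightarrow> (x, a) \<in> Q"
    unfolding P_def by blast+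
  have c_one: "\<not> c Q x \<one>" for Q
    using c_mult[OF x one_closed one_closed, of Q] x by (auto simp: act_one)
  have c_inv: "c Q x (inv g) = c Q x g" if "g \<in> stab x" for Q g
  proof -
    have "g \<in> carrier G" "x \<triangleright> g = x" using that by (auto simp: stab_def)
    then show ?thesis using c_mult[OF x, of g "inv g" Q] c_one[of Q] by simp
  qed
  define p where "p = (\<lambda>v. SOME g. g \<in> carrier G \<and> x \<triangleright> g = v)"
  have p: "p v \<in> carrier G" "x \<triangleright> p v = v" if "v \<in> orb x" for v
  proof -
    have "\<exists>g. g \<in> carrier G \<and> x \<triangleright> g = v" using that by (auto simp: orb_def)
    from someI_ex[OF this] show "p v \<in> carrier G" "x \<triangleright> p v = v" by (simp_all add: p_def)
  qed
  have V: "?V \<subseteq> orb x" using verts_orb[OF x E(3)] .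
  obtain v0 where v0: "v0 \<in> ?V" using E(2) by (auto simp: verts_def)
  \<comment> \<open>Parities along the paths \<open>p v\<close> are recorded relative to the one at
    \<open>v0\<close>. This leaves \<open>card S + (card ?V - 1)\<close> bits, whence the
    \<open>+ 1\<close> in the bound.\<close>
  define \<Phi> where "\<Phi> = (\<lambda>Q. ({s \<in> S. c Q x s}, {v \<in> ?V - {v0}. c Q x (p v) \<noteq> c Q x (p v0)}))"
  have "inj_on \<Phi> (Pow E)"
  proof (rule inj_onI)
    fix Q Q' assume Q: "Q \<in> Pow E" "Q' \<in> Pow E" and eq: "\<Phi> Q = \<Phi> Q'"
    have gens: "c Q x g = c Q' x g" if "g \<in> S" for g
      using eq that unfolding \<Phi>_def by blast
    have stab: "c Q x g = c Q' x g" if "g \<in> generate G S" for g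
      using that
    proof (induction rule: generate.induct)
      case one
      then show ?case by (simp add: c_one)
    next
      case (incl h)
      then show ?case by (rule gens)
    next
      case (inv h)
      then have "h \<in> stab x" using S(2) generate.incl by metis
      then show ?case using gens inv by (simp add: c_inv)
    next
      case (eng g h)
      then have "g \<in> stab x" "h \<in> stab x" using S(2) by auto
      then show ?case using eng c_mult[OF x] by (simp add: stab_def)
    qed
    have diff: "(c Q x (p v) \<noteq> c Q' x (p v)) = (c Q x (p v0) \<noteq> c Q' x (p v0))" if "v \<in> ?V" for v
    proof (cases "v = v0")
      case False
      then have "c Q x (p v) \<noteq> c Q x (p v0) \<longleftrightarrow> c Q' x (p v) \<noteq> c Q' x (p v0)"
        using eq that unfolding \<Phi>_def by blast
      then show ?thesis by blast
    qed simp
    have "(v, a) \<in> Q \<longleftrightarrow> (v, a) \<in> Q'" if e: "(v, a) \<in> E" for v a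
    proof -
      have va: "v \<in> ?V" "v \<triangleright> a \<in> ?V" using e by (force simp: verts_def)+
      have a: "a \<in> A" "a \<in> carrier G" using e E(3) basis_carrier by auto
      have vo: "v \<in> orb x" "v \<triangleright> a \<in> orb x" using va V by auto
      \<comment> \<open>The loop at \<open>x\<close> through the edge \<open>(v, a)\<close>. Its
        parity is determined on the stabiliser by \<open>S\<close>. It differs from membership of
        the edge by the parities of two paths, so the unknown common sign cancels.\<close>
      define h where "h = p v \<otimes> a \<otimes> inv (p (v \<triangleright> a))"
      have h: "h \<in> carrier G" "h \<otimes> p (v \<triangleright> a) = p v \<otimes> a"
        using a p[OF vo(1)] p[OF vo(2)] by (simp_all add: h_def m_assoc)
      have "x \<triangleright> (p v \<otimes> a) = v \<triangleright> a" using a x p[OF vo(1)] by (simp add: act_mult)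
      then have "x \<triangleright> h = x"
        using act_inv_cancel(1)[OF x, of "p (v \<triangleright> a)"] a x p[OF vo(1)] p[OF vo(2)]
        by (simp add: h_def act_mult)
      then have hs: "h \<in> stab x" using h by (simp add: stab_def)
      have key: "(c R x h \<noteq> c R x (p (v \<triangleright> a))) = (c R x (p v) \<noteq> ((v, a) \<in> R))" for R
        using c_mult[OF x h(1), of "p (v \<triangleright> a)" R] c_mult[OF x, of "p v" a R] h p[OF vo(1)] p[OF vo(2)]
          a c_basis[of v a R] vo orb_subset[OF x] \<open>x \<triangleright> h = x\<close> by auto
      show ?thesis
        using key[of Q] key[of Q'] stab[of h] hs S(2) diff[OF va(1)] diff[OF va(2)] by blast
    qed
    then show "Q = Q'" using Q by auto
  qed
  moreover have "\<Phi> ` Pow E \<subseteq> Pow S \<times> Pow (?V - {v0})" by (auto simp: \<Phi>_def)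
  ultimately have "card (Pow E) \<le> card (Pow S \<times> Pow (?V - {v0}))"
    using S E by (intro card_inj_on_le[of \<Phi>]) (auto simp: finite_verts)
  then have "2 ^ card E \<le> (2::nat) ^ (card S + card (?V - {v0}))"
    using S E by (simp add: card_Pow finite_verts card_cartesian_product power_add)
  then have "card E \<le> card S + card (?V - {v0})" by simp
  moreover have "Suc (card (?V - {v0})) = card ?V"
    using v0 E(1) by (intro card_Suc_Diff1) (simp_all add: finite_verts)
  ultimately show ?thesis by simp
qed

end

lemma Inf_enat_mem: "S \<noteq> {} \<Longrightarrow> Inf S \<in> (S :: enat set)"
  unfolding Inf_enat_def using LeastI[of "\<lambda>x. x \<in> S"] by auto

text \<open>Reduced words form a stack on which \<open>push\<close> realises multiplication by a letter in the free
  group; the head of the list is the last letter of the word.\<close>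

definition push :: "'e \<times> bool \<Rightarrow> ('e \<times> bool) list \<Rightarrow> ('e \<times> bool) list" where
  "push l u = (if u \<noteq> [] \<and> hd u = (fst l, \<not> snd l) then tl u else l # u)"

lemma reduced_word_Cons:
  "reduced_word (l # u) \<longleftrightarrow> reduced_word u \<and> (u = [] \<or> hd u \<noteq> (fst l, \<not> snd l))"
  by (cases l; cases u) auto

lemma reduced_push: "reduced_word u \<Longrightarrow> reduced_word (push l u)"
  by (cases u) (auto simp: push_def reduced_word_Cons)

lemma push_cancel: "reduced_word u \<Longrightarrow> push (e, \<not> s) (push (e, s) u) = u"
  by (cases u) (auto simp: push_def reduced_word_Cons)

text \<open>No push cancels: reducedness excludes cancellation between consecutive letters of
  \<open>w\<close>, and the second hypothesis excludes it between the first letter and the top of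
  the stack.\<close>

lemma fold_push:
  "reduced_word w \<Longrightarrow> u = [] \<or> w = [] \<or> hd u \<noteq> (fst (hd w), \<not> snd (hd w)) \<Longrightarrow>
    fold push w u = rev w @ u"
proof (induction w arbitrary: u)
  case (Cons l w)
  then have "push l u = l # u" by (auto simp: push_def)
  moreover have "w = [] \<or> l \<noteq> (fst (hd w), \<not> snd (hd w))"
    using Cons.prems(1) by (cases l) (auto simp: reduced_word_Cons prod_eq_iff)
  then have "fold push w (l # u) = rev w @ l # u"
    using Cons.prems(1) by (intro Cons.IH) (auto simp: reduced_word_Cons)
  ultimately show ?case by simp
qed simp

lemma reduced_word_map:
  "reduced_word w \<Longrightarrow> inj_on k (fst ` set w) \<Longrightarrow> reduced_word (map (map_prod k id) w)"
  by (induction w rule: reduced_word.induct) (auto simp: inj_on_def)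

section \<open>Spanning trees, Schreier generators and reduced rank\<close>

context free_group_action
begin

text \<open>Take \<open>d v\<close> to be the length of a shortest word leading from
  \<open>z\<close> to \<open>v\<close>. The last letter of such a word gives the parent and the tree
  edge, which may point either way; the strict decrease of \<open>d\<close> excludes cycles.\<close>

lemma spanning_tree:
  assumes z: "z \<in> \<Omega>"
  obtains d :: "'v \<Rightarrow> nat" and par :: "'v \<Rightarrow> 'v" and pe :: "'v \<Rightarrow> 'v \<times> 'a"
  where "\<And>v. v \<in> orb z - {z} \<Longrightarrow> par v \<in> orb z \<and> d (par v) < d v \<and>
    (\<exists>a\<in>A. pe v = (par v, a) \<and> par v \<triangleright> a = v \<or> pe v = (v, a) \<and> v \<triangleright> a = par v)"
proof -
  have AG: "A \<subseteq> carrier G" "generate G A = carrier G" using basis by (auto simp: free_basis_def)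
  define W where "W = (\<lambda>v n. \<exists>w. fst ` set w \<subseteq> A \<and> length w = n \<and> z \<triangleright> word_eval G w = v)"
  define d where "d = (\<lambda>v. LEAST n. W v n)"
  define Q where "Q = (\<lambda>v q. fst q \<in> orb z \<and> d (fst q) < d v \<and>
    (\<exists>a\<in>A. snd q = (fst q, a) \<and> fst q \<triangleright> a = v \<or> snd q = (v, a) \<and> v \<triangleright> a = fst q))"
  have "\<exists>q. Q v q" if v: "v \<in> orb z - {z}" for v
  proof -
    obtain g where "g \<in> carrier G" "z \<triangleright> g = v" using v by (auto simp: orb_def)
    then have "\<exists>n. W v n"
      using generate_word_eval[OF AG(1), of g] AG(2) unfolding W_def by auto
    then have "W v (d v)" unfolding d_def by (rule LeastI_ex)
    then obtain w where w: "fst ` set w \<subseteq> A" "length w = d v" "z \<triangleright> word_eval G w = v"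
      unfolding W_def by auto
    have "w \<noteq> []" using w(3) v z act_one by auto
    then obtain u a s where us: "w = u @ [(a, s)]" by (metis rev_exhaust surj_pair)
    have u: "fst ` set u \<subseteq> A" "fst ` set u \<subseteq> carrier G" "a \<in> A" "a \<in> carrier G"
      using w(1) us AG(1) by auto
    let ?y = "z \<triangleright> word_eval G u"
    have y: "?y \<in> orb z" "?y \<in> \<Omega>" using u z word_eval_closed act_closed by (auto simp: orb_def)
    have "W ?y (length u)" using u unfolding W_def by auto
    then have "d ?y \<le> length u" unfolding d_def by (rule Least_le)
    then have dy: "d ?y < d v" using w(2) us by simp
    have v: "v = ?y \<triangleright> (if s then a else inv a)"
      using w(3) u z by (simp add: us word_eval_append word_eval_closed act_mult split: if_splits)
    show ?thesis
    proof (cases s)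
      case True
      then show ?thesis using y dy v u by (intro exI[of _ "(?y, (?y, a))"]) (auto simp: Q_def)
    next
      case False
      then have "v \<triangleright> a = ?y" using v y u by simp
      then show ?thesis using y dy u by (intro exI[of _ "(?y, (v, a))"]) (auto simp: Q_def)
    qed
  qed
  then obtain q where "\<And>v. v \<in> orb z - {z} \<Longrightarrow> Q v (q v)" by metis
  then show thesis unfolding Q_def by (rule that[of "fst \<circ> q" d "snd \<circ> q", unfolded comp_def])
qed

text \<open>Freeness: \<open>G\<close> acts on pairs of a vertex and a reduced word in the non-tree edges \<open>N\<close>, each
  non-tree edge that is traversed being pushed onto the word. Reading a reduced word in the generators
  \<open>h e\<close> from \<open>(z, [])\<close> therefore leaves that word on the stack.\<close>

lemma nielsen_schreier:
  assumes z: "z \<in> \<Omega>"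
    and tree: "\<And>v. v \<in> orb z - {z} \<Longrightarrow> par v \<in> orb z \<and> (d (par v) :: nat) < d v \<and>
      (\<exists>a\<in>A. pe v = (par v, a) \<and> par v \<triangleright> a = v \<or> pe v = (v, a) \<and> v \<triangleright> a = par v)"
  defines "N \<equiv> orb z \<times> A - pe ` (orb z - {z})"
  shows "\<exists>h. free_basis G (stab z) (h ` N)"
proof -
  have orbI: "x \<triangleright> g \<in> orb z" if "x \<in> orb z" "g \<in> carrier G" for x g
    using orb_closed[OF z that] .
  have inO: "x \<in> \<Omega>" if "x \<in> orb z" for x using that orb_subset[OF z] by auto
  \<comment> \<open>\<open>lab v\<close> is the group element read when walking from
    \<open>par v\<close> to \<open>v\<close>, inverted if the tree edge points towards the parent.
    The element \<open>t v\<close> read along the tree path from \<open>z\<close> to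
    \<open>v\<close> is then defined by recursion on \<open>d\<close>.\<close>
  define lab where "lab = (\<lambda>v. if fst (pe v) = par v then snd (pe v) else inv (snd (pe v)))"
  define t where "t = wfrec (measure d) (\<lambda>f v. if v = z then \<one> else f (par v) \<otimes> lab v)"
  have tz: "t z = \<one>" unfolding t_def by (subst wfrec) simp_all
  have t_step: "t v = t (par v) \<otimes> lab v" if "v \<in> orb z - {z}" for v
    using tree[OF that] that unfolding t_def by (subst wfrec) (simp_all add: cut_apply)
  have tree_induct: "P v" if "v \<in> orb z" "P z" "\<And>v. v \<in> orb z - {z} \<Longrightarrow> P (par v) \<Longrightarrow> P v" for P v
    using that(1)
  proof (induction "d v" arbitrary: v rule: less_induct)
    case less
    then show ?case using that(2,3) tree[of v] by (cases "v = z") auto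
  qed
  have edge: "\<exists>a\<in>A. (pe v = (par v, a) \<and> par v \<triangleright> a = v \<and> lab v = a) \<or>
      (pe v = (v, a) \<and> v \<triangleright> a = par v \<and> lab v = inv a)" if v: "v \<in> orb z - {z}" for v
  proof -
    obtain a where a: "a \<in> A" "pe v = (par v, a) \<and> par v \<triangleright> a = v \<or> pe v = (v, a) \<and> v \<triangleright> a = par v"
      using tree[OF v] by blast
    moreover have "par v \<noteq> v" using tree[OF v] by auto
    ultimately show ?thesis by (intro bexI[of _ a]) (auto simp: lab_def)
  qed
  have labG: "lab v \<in> carrier G" if "v \<in> orb z - {z}" for v
    using edge[OF that] basis_carrier by auto
  have t: "t v \<in> carrier G \<and> z \<triangleright> t v = v" if "v \<in> orb z" for v
    using that
  proof (rule tree_induct)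
    show "t z \<in> carrier G \<and> z \<triangleright> t z = z" using z by (simp add: tz act_one)
    fix v assume v: "v \<in> orb z - {z}" and IH: "t (par v) \<in> carrier G \<and> z \<triangleright> t (par v) = par v"
    have "par v \<triangleright> lab v = v"
      using edge[OF v] basis_carrier v inO act_inv_cancel(1)[of v] by fastforce
    then show "t v \<in> carrier G \<and> z \<triangleright> t v = v"
      using IH labG[OF v] z by (simp add: t_step[OF v] act_mult)
  qed
  have t_edge: "t x \<otimes> a = t (x \<triangleright> a)" if e: "(x, a) \<in> orb z \<times> A - N" for x a
  proof -
    obtain v where v: "v \<in> orb z - {z}" "pe v = (x, a)" using e unfolding N_def by force
    have G: "t (par v) \<in> carrier G" "a \<in> carrier G" using t tree[OF v(1)] e basis_carrier by auto
    from edge[OF v(1)] show ?thesis using v G by (auto simp: t_step[OF v(1)] m_assoc)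
  qed
  \<comment> \<open>The Schreier generator: out along the tree to \<open>x\<close>, across
    \<open>a\<close>, and back along the tree. It is trivial on tree edges.\<close>
  define h where "h = (\<lambda>(x, a). t x \<otimes> a \<otimes> inv t (x \<triangleright> a))"
  have hG: "h (x, a) \<in> carrier G" if "x \<in> orb z" "a \<in> carrier G" for x a
    using that t orbI by (simp add: h_def)
  have h_stab: "h (x, a) \<in> stab z" if "x \<in> orb z" "a \<in> carrier G" for x a
  proof -
    have "z \<triangleright> h (x, a) = x \<triangleright> a \<triangleright> inv t (x \<triangleright> a)"
      using that t orbI z by (simp add: h_def act_mult)
    also have "\<dots> = z"
      using act_inv_cancel(1)[OF z, of "t (x \<triangleright> a)"] t[OF orbI[OF that]] by simp
    finally show ?thesis using hG[OF that] by (simp add: stab_def)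
  qed
  have hN: "h ` N \<subseteq> stab z" using h_stab basis_carrier by (auto simp: N_def)
  then have hNG: "h ` N \<subseteq> carrier G" by (auto simp: stab_def)
  have gen_sub: "subgroup (generate G (h ` N)) G" using generate_is_subgroup[OF hNG] .
  \<comment> \<open>All vertices are treated at once because \<open>h (x, g \<otimes> k) = h (x, g)
    \<otimes> h (x \<triangleright> g, k)\<close> changes the base vertex. For \<open>g\<close> in
    \<open>stab z\<close> the case \<open>x = z\<close> gives \<open>g\<close> itself.\<close>
  have gen: "\<forall>x\<in>orb z. h (x, g) \<in> generate G (h ` N)" if "g \<in> carrier G" for g
    using that
  proof (induction rule: basis_induct)
    case one
    then show ?case using t inO by (simp add: h_def act_one generate.one)
  next
    case (incl a)
    show ?case
    proof
      fix x assume x: "x \<in> orb z"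
      show "h (x, a) \<in> generate G (h ` N)"
      proof (cases "(x, a) \<in> N")
        case True
        then show ?thesis by (intro generate.incl imageI)
      next
        case False
        then have "t x \<otimes> a = t (x \<triangleright> a)" using t_edge x incl by auto
        then show ?thesis
          using t[OF orbI[OF x basis_carrier[OF incl]]] by (simp add: h_def generate.one)
      qed
    qed
  next
    case (inv a)
    show ?case
    proof
      fix x assume x: "x \<in> orb z"
      let ?y = "x \<triangleright> inv a"
      have a: "a \<in> carrier G" using inv by (rule basis_carrier)
      have y: "?y \<in> orb z" "?y \<triangleright> a = x" using x a orbI inO by auto
      have "h (?y, a) \<in> generate G (h ` N)"
      proof (cases "(?y, a) \<in> N")
        case True
        then show ?thesis by (intro generate.incl imageI)
      next
        case False
        then have "t ?y \<otimes> a = t x" using t_edge[of ?y a] y inv by auto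
        then show ?thesis using t[OF x] y by (simp add: h_def generate.one)
      qed
      moreover have "h (x, inv a) = inv (h (?y, a))"
        using t[OF x] t[OF y(1)] y a by (simp add: h_def inv_mult_group m_assoc)
      ultimately show "h (x, inv a) \<in> generate G (h ` N)"
        using subgroup.m_inv_closed[OF gen_sub] by simp
    qed
  next
    case (mult g k)
    show ?case
    proof
      fix x assume x: "x \<in> orb z"
      have y: "x \<triangleright> g \<in> orb z" "x \<triangleright> g \<triangleright> k \<in> orb z" using x mult orbI by auto
      have "h (x, g \<otimes> k) = h (x, g) \<otimes> h (x \<triangleright> g, k)"
        using mult(1,2) t[OF x] t[OF y(1)] t[OF y(2)] inO[OF x]
        by (simp add: h_def act_mult m_assoc inv_solve_left)
      then show "h (x, g \<otimes> k) \<in> generate G (h ` N)"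
        using mult(3,4) x y subgroup.m_closed[OF gen_sub] by simp
    qed
  qed
  have "generate G (h ` N) = stab z"
  proof
    show "generate G (h ` N) \<subseteq> stab z"
      using generate_subgroup_incl[OF hN subgroup_stab[OF z]] .
    show "stab z \<subseteq> generate G (h ` N)"
    proof
      fix g assume g: "g \<in> stab z"
      then have "h (z, g) = g" by (simp add: h_def stab_def tz)
      then show "g \<in> generate G (h ` N)"
        using gen[of g] g orb_refl[OF z] by (auto simp: stab_def)
    qed
  qed
  moreover have "word_eval G w \<noteq> \<one>" if w: "fst ` set w \<subseteq> h ` N" "w \<noteq> []" "reduced_word w" for w
  proof
    assume w1: "word_eval G w = \<one>"
    let ?R = "Collect reduced_word :: (('v \<times> 'a) \<times> bool) list set"
    let ?S = "orb z \<times> ?R"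
    define f where "f = (\<lambda>a (x, u). (x \<triangleright> a, if (x, a) \<in> N then push ((x, a), True) u else u))"
    define f' where "f' = (\<lambda>a (x, u). (x \<triangleright> inv a,
      if (x \<triangleright> inv a, a) \<in> N then push ((x \<triangleright> inv a, a), False) u else u))"
    have pc: "push (e, False) (push (e, True) u) = u" "push (e, True) (push (e, False) u) = u"
      if "reduced_word u" for e and u :: "(('v \<times> 'a) \<times> bool) list"
      using push_cancel[OF that, of e True] push_cancel[OF that, of e False] by simp_all
    have bij: "bij_betw (f a) ?S ?S" if "a \<in> A" for a
      using basis_carrier[OF that]
      by (intro bij_betwI[where g = "f' a"])
        (auto simp: f_def f'_def orbI inO reduced_push pc)
    obtain \<rho> where
    "\<forall>s\<in>?S. \<rho> \<one> s = s" "\<forall>a\<in>A. \<forall>s\<in>?S. \<rho> a s = f a s"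
    "\<forall>g\<in>carrier G. \<forall>h\<in>carrier G. \<forall>s\<in>?S. \<rho> (g \<otimes> h) s = \<rho> h (\<rho> g s)"
    using free_basis_action[OF basis, of f, OF bij] by blast
  note \<rho> = this[rule_format]
    have \<rho>_inv: "\<rho> (inv g) s' = s" if "g \<in> carrier G" "s \<in> ?S" "\<rho> g s = s'" for g s s'
      using \<rho>(1)[OF that(2)] \<rho>(3)[OF that(1) inv_closed[OF that(1)] that(2)] that by simp
    \<comment> \<open>Tree edges push nothing, so walking along the tree leaves the stack as it is.
      A Schreier generator therefore only pushes its own non-tree edge.\<close>
    have \<rho>_t: "\<rho> (t v) (z, u) = (v, u)" if "v \<in> orb z" "u \<in> ?R" for v u
      using that(1)
    proof (rule tree_induct)
      show "\<rho> (t z) (z, u) = (z, u)" using \<rho>(1) that(2) orb_refl[OF z] by (simp add: tz)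
      fix v assume v: "v \<in> orb z - {z}" and IH: "\<rho> (t (par v)) (z, u) = (par v, u)"
      have pv: "par v \<in> orb z" using tree[OF v] by simp
      have nN: "pe v \<notin> N" using v by (auto simp: N_def)
      obtain a where a: "a \<in> A" "(pe v = (par v, a) \<and> par v \<triangleright> a = v \<and> lab v = a) \<or>
          (pe v = (v, a) \<and> v \<triangleright> a = par v \<and> lab v = inv a)"
        using edge[OF v] by blast
      have "\<rho> (lab v) (par v, u) = (v, u)"
        using a(2)
      proof
        assume "pe v = (par v, a) \<and> par v \<triangleright> a = v \<and> lab v = a"
        then show ?thesis using \<rho>(2)[OF a(1), of "(par v, u)"] nN pv that(2) by (simp add: f_def)
      next
        assume "pe v = (v, a) \<and> v \<triangleright> a = par v \<and> lab v = inv a"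
        then show ?thesis
          using \<rho>(2)[OF a(1), of "(v, u)"] nN v that(2) \<rho>_inv[OF basis_carrier[OF a(1)], of "(v, u)"]
          by (simp add: f_def)
      qed
      then show "\<rho> (t v) (z, u) = (v, u)"
        using \<rho>(3)[of "t (par v)" "lab v" "(z, u)"] t[OF pv] labG[OF v] IH orb_refl[OF z] that(2)
        by (simp add: t_step[OF v])
    qed
    have \<rho>_h: "\<rho> (h e) (z, u) = (z, push (e, True) u)" if e: "e \<in> N" and u: "u \<in> ?R" for e u
    proof -
      obtain x a where xa: "e = (x, a)" "x \<in> orb z" "a \<in> A" using e by (auto simp: N_def)
      have a: "a \<in> carrier G" and y: "x \<triangleright> a \<in> orb z" using xa basis_carrier orbI by auto
      let ?u = "push (e, True) u"
      have u': "?u \<in> ?R" using u by (simp add: reduced_push)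
      have zS: "(z, u) \<in> ?S" "(z, ?u) \<in> ?S" using u u' orb_refl[OF z] by auto
      have "\<rho> (t x \<otimes> a) (z, u) = (x \<triangleright> a, ?u)"
        using \<rho>(3)[of "t x" a "(z, u)"] \<rho>_t[OF xa(2) u] t[OF xa(2)] a zS \<rho>(2)[OF xa(3), of "(x, u)"] xa e u
        by (simp add: f_def)
      moreover have "\<rho> (inv t (x \<triangleright> a)) (x \<triangleright> a, ?u) = (z, ?u)"
        using \<rho>_inv[OF _ zS(2) \<rho>_t[OF y u']] t[OF y] by simp
      ultimately show ?thesis
        using \<rho>(3)[of "t x \<otimes> a" "inv t (x \<triangleright> a)" "(z, u)"] t[OF xa(2)] t[OF y] a zS
        by (simp add: h_def xa(1))
    qed
    have \<rho>_letter: "\<rho> (if s then h e else inv (h e)) (z, u) = (z, push (e, s) u)"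
      if e: "e \<in> N" and u: "u \<in> ?R" for e u s
    proof (cases s)
      case False
      have "\<rho> (h e) (z, push (e, False) u) = (z, u)"
        using \<rho>_h[OF e, of "push (e, False) u"] u pc by (simp add: reduced_push)
      then show ?thesis
        using \<rho>_inv[of "h e" "(z, push (e, False) u)"] hNG e u False orb_refl[OF z]
        by (auto simp: reduced_push)
    qed (simp add: \<rho>_h[OF e u])
    \<comment> \<open>Chooses one edge for each generator. Since \<open>h (k b) = b\<close>, the
      choice is injective, and so the word of edges is again reduced.\<close>
    define k where "k = inv_into N h"
    have k: "k b \<in> N" "h (k b) = b" if "b \<in> h ` N" for b
      using that by (simp_all add: k_def inv_into_into f_inv_into_f)
    have run: "\<rho> (word_eval G v) (z, u) = (z, fold push (map (map_prod k id) v) u)"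
      if "fst ` set v \<subseteq> h ` N" "u \<in> ?R" for v u
      using that
    proof (induction v arbitrary: u)
      case Nil
      then show ?case using \<rho>(1)[of "(z, u)"] orb_refl[OF z] by simp
    next
      case (Cons l v)
      obtain b s where l: "l = (b, s)" by force
      have b: "b \<in> h ` N" "b \<in> carrier G" using Cons.prems(1) l hNG by auto
      have v: "fst ` set v \<subseteq> h ` N" "fst ` set v \<subseteq> carrier G" using Cons.prems(1) hNG by auto
      have "\<rho> (word_eval G (l # v)) (z, u) = \<rho> (word_eval G v) (\<rho> (if s then b else inv b) (z, u))"
        unfolding l word_eval.simps using b word_eval_closed[OF v(2)] Cons.prems(2) orb_refl[OF z]
        by (intro \<rho>(3)) auto
      also have "\<rho> (if s then b else inv b) (z, u) = (z, push (k b, s) u)"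
        using \<rho>_letter[OF k(1)[OF b(1)] Cons.prems(2), of s] k(2)[OF b(1)] by metis
      also have "\<rho> (word_eval G v) \<dots> = (z, fold push (map (map_prod k id) v) (push (k b, s) u))"
        using Cons.prems(2) by (intro Cons.IH v) (simp add: reduced_push)
      finally show ?case by (simp add: l id_def)
    qed
    have inj: "inj_on k (fst ` set w)"
      using w(1) by (intro inj_onI) (metis k(2) subsetD)
    have "fold push (map (map_prod k id) w) [] = rev (map (map_prod k id) w)"
      using fold_push[OF reduced_word_map[OF w(3) inj], of "[]"] by simp
    then have "\<rho> \<one> (z, []) = (z, rev (map (map_prod k id) w))"
      using run[OF w(1), of "[]"] w1 by simp
    moreover have "\<rho> \<one> (z, []) = (z, [])" using \<rho>(1) orb_refl[OF z] by simp
    ultimately show False using w(2) by simp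
  qed
  ultimately have "free_basis G (stab z) (h ` N)"
    using hN by (simp add: free_basis_def)
  then show ?thesis by blast
qed

text \<open>Adding \<open>m + 1\<close> edges to a finite subtree of the spanning tree raises the number of edges minus
  the number of vertices from \<open>-1\<close> to \<open>m\<close>.\<close>

lemma rrk_stab_subgraph:
  assumes z: "z \<in> \<Omega>" and m: "enat m \<le> rrk G (stab z)"
  shows "\<exists>E. finite E \<and> E \<subseteq> orb z \<times> A \<and> card (verts (\<triangleright>) E) + m \<le> card E"
proof (cases "m = 0")
  \<comment> \<open>With truncated subtraction, \<open>m = 0\<close> does not force a positive rank,
    so no non-tree edge can be expected here; the empty subgraph serves.\<close>
  case True
  then show ?thesis by (intro exI[of _ "{}"]) (simp add: verts_def)
next
  case False
  obtain d :: "'v \<Rightarrow> nat" and par pe where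
    tree: "\<And>v. v \<in> orb z - {z} \<Longrightarrow> par v \<in> orb z \<and> d (par v) < d v \<and>
      (\<exists>a\<in>A. pe v = (par v, a) \<and> par v \<triangleright> a = v \<or> pe v = (v, a) \<and> v \<triangleright> a = par v)"
    using spanning_tree[OF z] by (metis (lifting))
  define N where "N = orb z \<times> A - pe ` (orb z - {z})"
  obtain h where h: "free_basis G (stab z) (h ` N)"
    using nielsen_schreier[OF z tree] unfolding N_def by blast
  have "enat (m + 1) \<le> free_rank G (stab z)"
    using m False unfolding rrk_def by (cases "free_rank G (stab z)") (auto simp: one_enat_def)
  also have "\<dots> \<le> (if finite (h ` N) then enat (card (h ` N)) else \<infinity>)"
    unfolding free_rank_def using h by (intro Inf_lower) blast
  finally have N_card: "m + 1 \<le> card N" if "finite N"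
    using that card_image_le[OF that, of h] by simp
  obtain N' where N': "N' \<subseteq> N" "finite N'" "card N' = m + 1"
  proof (cases "finite N")
    case True
    then show ?thesis using that obtain_subset_with_card_n[OF N_card] by metis
  next
    case False
    then show ?thesis using that infinite_arbitrarily_large by metis
  qed
  have N'O: "N' \<subseteq> orb z \<times> A" using N'(1) by (auto simp: N_def)
  \<comment> \<open>The vertex sets of finite subtrees containing the root: each vertex other than
    \<open>z\<close> brings its tree edge, so there is one edge fewer than vertices.\<close>
  define closed where "closed = (\<lambda>U. finite U \<and> z \<in> U \<and> U \<subseteq> orb z \<and> par ` (U - {z}) \<subseteq> U)"
  have hull1: "\<exists>U. closed U \<and> v \<in> U" if "v \<in> orb z" for v
    using that
  proof (induction "d v" arbitrary: v rule: less_induct)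
    case less
    show ?case
    proof (cases "v = z")
      case True
      then show ?thesis using orb_refl[OF z] by (intro exI[of _ "{z}"]) (simp add: closed_def)
    next
      case False
      then obtain U where "closed U" "par v \<in> U" using less tree[of v] by blast
      then show ?thesis
        using less.prems by (intro exI[of _ "insert v U"]) (auto simp: closed_def)
    qed
  qed
  have hull: "\<exists>U. closed U \<and> V \<subseteq> U" if "finite V" "V \<subseteq> orb z" for V
    using that
  proof (induction V rule: finite_induct)
    case empty
    then show ?case using hull1[OF orb_refl[OF z]] by blast
  next
    case (insert v V)
    then obtain U U' where "closed U" "V \<subseteq> U" "closed U'" "v \<in> U'" using hull1[of v] by auto
    then show ?case by (intro exI[of _ "U \<union> U'"]) (auto simp: closed_def)
  qed
  obtain U where U: "closed U" "verts (\<triangleright>) N' \<subseteq> U"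
    using hull[OF finite_verts[OF N'(2)] verts_orb[OF z N'O]] by blast
  \<comment> \<open>Two distinct vertices with the same tree edge would be parents of each other,
    against the decrease of \<open>d\<close>.\<close>
  have inj: "inj_on pe (U - {z})"
  proof (rule inj_onI)
    fix u v assume uv: "u \<in> U - {z}" "v \<in> U - {z}" and eq: "pe u = pe v"
    have o: "u \<in> orb z - {z}" "v \<in> orb z - {z}" using uv U(1) by (auto simp: closed_def)
    show "u = v"
    proof (rule ccontr)
      assume "u \<noteq> v"
      then have "u = par v" "v = par u" using tree[OF o(1)] tree[OF o(2)] eq by auto
      then show False using tree[OF o(1)] tree[OF o(2)] by auto
    qed
  qed
  define E where "E = pe ` (U - {z}) \<union> N'"
  have UO: "U - {z} \<subseteq> orb z - {z}" and fU: "finite U" and zU: "z \<in> U" and par: "par ` (U - {z}) \<subseteq> U"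
    using U(1) by (auto simp: closed_def)
  have pe: "pe v \<in> orb z \<times> A \<and> fst (pe v) \<in> U \<and> fst (pe v) \<triangleright> snd (pe v) \<in> U" if "v \<in> U - {z}" for v
  proof -
    have "v \<in> orb z - {z}" "par v \<in> U" using that UO par by auto
    then show ?thesis using tree[of v] that by auto
  qed
  have "verts (\<triangleright>) E \<subseteq> U"
    using U(2) pe unfolding E_def verts_Un by (auto 0 3 simp: verts_def image_image case_prod_beta)
  then have "card (verts (\<triangleright>) E) \<le> card U" using fU by (rule card_mono[rotated])
  moreover have "card E = card (pe ` (U - {z})) + card N'"
    unfolding E_def using fU N'(1,2) UO by (intro card_Un_disjoint) (auto simp: N_def)
  moreover have "card (pe ` (U - {z})) = card (U - {z})" by (rule card_image[OF inj])
  moreover have "Suc (card (U - {z})) = card U" using fU zU by (rule card_Suc_Diff1)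
  ultimately have "card (verts (\<triangleright>) E) + m \<le> card E" using N'(3) by simp
  moreover have "finite E" "E \<subseteq> orb z \<times> A"
    using fU N'(2) N'O pe unfolding E_def by blast+
  ultimately show ?thesis by blast
qed

text \<open>If the rank is finite, the infimum over bases is attained because \<open>enat\<close> is
  well-ordered, and a basis attaining it is a finite generating set for
  \<open>orbit_subgraph_bound\<close>. That bound concerns nonempty \<open>E\<close>, so the empty
  subgraph is separated.\<close>

lemma subgraph_le_rrk:
  assumes x: "x \<in> \<Omega>" and E: "finite E" "E \<subseteq> orb x \<times> A"
  shows "enat (card E - card (verts (\<triangleright>) E)) \<le> rrk G (stab x)"
proof (cases "free_rank G (stab x)")
  case (enat n)
  let ?R = "{r. \<exists>B. free_basis G (stab x) B \<and> r = (if finite B then enat (card B) else \<infinity>)}"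
  have "?R \<noteq> {}" using enat by (auto simp: free_rank_def Inf_enat_def split: if_splits)
  then have "Inf ?R \<in> ?R" by (rule Inf_enat_mem)
  then have "enat n \<in> ?R" using enat by (simp add: free_rank_def)
  then obtain B where B: "free_basis G (stab x) B" "finite B" "card B = n"
    by (auto split: if_splits)
  have "card E - card (verts (\<triangleright>) E) \<le> n - 1"
  proof (cases "E = {}")
    case False
    then have "card E + 1 \<le> card (verts (\<triangleright>) E) + card B"
      using B by (intro orbit_subgraph_bound[OF x _ _ E(1) _ E(2)]) (auto simp: free_basis_def)
    then show ?thesis using B(3) by simp
  qed simp
  then show ?thesis by (simp add: rrk_def enat one_enat_def)
qed (simp add: rrk_def)

section \<open>Sums of reduced ranks over disjoint orbits\<close>

lemma orbs_meet:
  assumes "x \<in> \<Omega>" "y \<in> \<Omega>" "orb x \<inter> orb y \<noteq> {}"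
  shows "\<exists>g\<in>carrier G. x \<triangleright> g = y"
proof -
  obtain g h where gh: "g \<in> carrier G" "h \<in> carrier G" "x \<triangleright> g = y \<triangleright> h"
    using assms(3) by (auto simp: orb_def)
  then have "x \<triangleright> (g \<otimes> inv h) = y" using assms by (simp add: act_mult)
  then show ?thesis using gh by blast
qed

text \<open>Subgraphs in disjoint orbits have no edge in common, so their edge numbers add up, while
  vertex numbers are subadditive. The surplus \<open>m\<close> is distributed over the
  terms.\<close>

lemma sum_rrk_stab_subgraph:
  assumes "finite F" "z ` F \<subseteq> \<Omega>"
    and disj: "\<And>w w'. w \<in> F \<Longrightarrow> w' \<in> F \<Longrightarrow> w \<noteq> w' \<Longrightarrow> orb (z w) \<inter> orb (z w') = {}"
    and "enat m \<le> (\<Sum>w\<in>F. rrk G (stab (z w)))"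
  shows "\<exists>E. finite E \<and> E \<subseteq> (\<Union>w\<in>F. orb (z w)) \<times> A \<and> card (verts (\<triangleright>) E) + m \<le> card E"
  using assms
proof (induction F arbitrary: m rule: finite_induct)
  case empty
  then show ?case by (intro exI[of _ "{}"]) (simp add: verts_def zero_enat_def)
next
  case (insert w F)
  let ?r = "rrk G (stab (z w))" and ?s = "\<Sum>w\<in>F. rrk G (stab (z w))"
  have "enat m \<le> ?r + ?s" using insert by simp
  \<comment> \<open>The first term takes as much of \<open>m\<close> as it can carry, the remaining
    terms take the rest.\<close>
  then obtain m1 m2 where m: "m = m1 + m2" "enat m1 \<le> ?r" "enat m2 \<le> ?s"
  proof (cases "enat m \<le> ?r")
    case True
    then show ?thesis using that[of m 0] by (simp add: zero_enat_def[symmetric])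
  next
    case False
    then obtain r where r: "?r = enat r" "r < m" by (cases ?r) auto
    then have "enat (m - r) \<le> ?s" using \<open>enat m \<le> ?r + ?s\<close> by (cases ?s) auto
    then show ?thesis using that[of r "m - r"] r by simp
  qed
  have zw: "z w \<in> \<Omega>" using insert.prems(1) by simp
  obtain E1 where E1: "finite E1" "E1 \<subseteq> orb (z w) \<times> A" "card (verts (\<triangleright>) E1) + m1 \<le> card E1"
    using rrk_stab_subgraph[OF zw m(2)] by blast
  obtain E2 where E2: "finite E2" "E2 \<subseteq> (\<Union>w\<in>F. orb (z w)) \<times> A"
      "card (verts (\<triangleright>) E2) + m2 \<le> card E2"
    using insert.IH[of m2] insert.prems m(3) by auto
  have "orb (z w) \<inter> (\<Union>w\<in>F. orb (z w)) = {}"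
    using insert.prems(2)[of w] insert.hyps(2) by fastforce
  then have "E1 \<inter> E2 = {}" using E1(2) E2(2) by blast
  then have "card (E1 \<union> E2) = card E1 + card E2" using E1(1) E2(1) by (rule card_Un_disjoint[rotated 2])
  moreover have "card (verts (\<triangleright>) (E1 \<union> E2)) \<le> card (verts (\<triangleright>) E1) + card (verts (\<triangleright>) E2)"
    unfolding verts_Un by (rule card_Un_le)
  ultimately have "card (verts (\<triangleright>) (E1 \<union> E2)) + m \<le> card (E1 \<union> E2)"
    using E1(3) E2(3) m(1) by simp
  moreover have "finite (E1 \<union> E2)" "E1 \<union> E2 \<subseteq> (\<Union>w\<in>insert w F. orb (z w)) \<times> A"
    using E1(1,2) E2(1,2) by auto
  ultimately show ?case by blast
qed

end

text \<open>Finite subgraphs only witness finite lower bounds, whereas the sum of reduced ranks may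
  be infinite; this passes from the former to the latter.\<close>

lemma enat_le_by_nats:
  fixes s r :: enat
  assumes "\<And>m. enat m \<le> s \<Longrightarrow> enat m \<le> r"
  shows "s \<le> r"
proof (cases s)
  case infinity
  then have "enat (Suc n) \<le> r" for n using assms by simp
  then show ?thesis by (cases r) (auto, metis Suc_n_not_le_n)
qed (use assms in simp)

section \<open>The product of the two coset actions and the inequality\<close>

theorem theorem7p14:
  fixes G :: "('a, 'b) monoid_scheme" and A H K W :: "'a set"
  assumes "group G"
    and "free_basis G (carrier G) A"
    and "subgroup H G" and "subgroup K G"
    and "W \<subseteq> carrier G"
    and "bij_betw (\<lambda>w. double_coset G H w K) W
           {double_coset G H w K | w. w \<in> carrier G}"
  shows "esum (\<lambda>w. rrk G (conj_sub G H w \<inter> K)) W \<le> 2 * rrk G H * rrk G K"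
proof -
  interpret group G by (rule assms(1))
  \<comment> \<open>All subsets of the group under right translation, so that one action serves
    \<open>H\<close> and \<open>K\<close> alike. The orbit of a subgroup is its set of right cosets,
    and its stabiliser is the subgroup itself.\<close>
  let ?\<Omega> = "Pow (carrier G)"
  define act where "act = (\<lambda>M g. M #>\<^bsub>G\<^esub> g)"
  define act2 where "act2 = (\<lambda>p g. (act (fst p) g, act (snd p) g))"
  interpret C: free_group_action G A ?\<Omega> act
    by unfold_locales
      (use assms(2) r_coset_subset_G in \<open>auto simp: act_def coset_mult_one coset_mult_assoc\<close>)
  interpret P: free_group_action G A "?\<Omega> \<times> ?\<Omega>" act2
    by unfold_locales
      (simp_all add: act2_def mem_Times_iff prod_eq_iff C.basis C.act_closed C.act_one C.act_mult
        del: Pow_iff)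
  have HK: "H \<in> ?\<Omega>" "K \<in> ?\<Omega>" using assms(3,4) subgroup.subset by auto
  have stab_C: "C.stab L = L" if "subgroup L G" for L
    using that subgroup.subset[OF that] coset_join1[OF _ _ that] coset_join2[OF _ that]
    unfolding C.stab_def by (auto simp: act_def)
  define z where "z = (\<lambda>w. (act H w, K))"
  have z: "z w \<in> ?\<Omega> \<times> ?\<Omega>" if "w \<in> carrier G" for w
    using that HK C.act_closed by (auto simp: z_def)
  have stab_z: "P.stab (z w) = conj_sub G H w \<inter> K" if w: "w \<in> carrier G" for w
  proof -
    have "act (act H w) g = act H w \<longleftrightarrow> g \<in> conj_sub G H w" if g: "g \<in> carrier G" for g
    proof -
      have "act (act H w) g = act H w \<longleftrightarrow> act H (w \<otimes>\<^bsub>G\<^esub> g \<otimes>\<^bsub>G\<^esub> inv\<^bsub>G\<^esub> w) = H"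
        using C.act_inv_cancel[OF HK(1) w] C.act_inv_cancel[OF C.act_closed[OF C.act_closed[OF HK(1) w] g] w] w g HK(1)
        by (auto simp: C.act_mult)
      also have "\<dots> \<longleftrightarrow> w \<otimes>\<^bsub>G\<^esub> g \<otimes>\<^bsub>G\<^esub> inv\<^bsub>G\<^esub> w \<in> H"
        using stab_C[OF assms(3)] w g unfolding C.stab_def by auto
      also have "\<dots> \<longleftrightarrow> g \<in> conj_sub G H w"
      proof
        assume "w \<otimes>\<^bsub>G\<^esub> g \<otimes>\<^bsub>G\<^esub> inv\<^bsub>G\<^esub> w \<in> H"
        moreover have "g = inv\<^bsub>G\<^esub> w \<otimes>\<^bsub>G\<^esub> (w \<otimes>\<^bsub>G\<^esub> g \<otimes>\<^bsub>G\<^esub> inv\<^bsub>G\<^esub> w) \<otimes>\<^bsub>G\<^esub> w"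
          using w g by (simp add: m_assoc inv_solve_left)
        ultimately show "g \<in> conj_sub G H w" unfolding conj_sub_def by blast
      next
        assume "g \<in> conj_sub G H w"
        then obtain h where h: "h \<in> H" "g = inv\<^bsub>G\<^esub> w \<otimes>\<^bsub>G\<^esub> h \<otimes>\<^bsub>G\<^esub> w" by (auto simp: conj_sub_def)
        moreover have "h \<in> carrier G" using h(1) HK(1) by auto
        ultimately have "w \<otimes>\<^bsub>G\<^esub> g \<otimes>\<^bsub>G\<^esub> inv\<^bsub>G\<^esub> w = h"
          using w by (simp add: m_assoc) (simp flip: m_assoc)
        then show "w \<otimes>\<^bsub>G\<^esub> g \<otimes>\<^bsub>G\<^esub> inv\<^bsub>G\<^esub> w \<in> H" using h by simp
      qed
      finally show ?thesis .
    qed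
    moreover have "act K g = K \<longleftrightarrow> g \<in> K" if "g \<in> carrier G" for g
      using stab_C[OF assms(4)] that unfolding C.stab_def by auto
    ultimately show ?thesis using HK(2) unfolding P.stab_def by (auto simp: z_def act2_def)
  qed
  \<comment> \<open>If \<open>g\<close> takes \<open>(Hw, K)\<close> to \<open>(Hw', K)\<close>,
    then \<open>g\<close> lies in \<open>K\<close> and \<open>Hw' = Hwg\<close>, so
    \<open>Hw'K = HwgK = HwK\<close>; distinct representatives in \<open>W\<close> have distinct
    double cosets.\<close>
  have disj: "P.orb (z w) \<inter> P.orb (z w') = {}" if w: "w \<in> W" "w' \<in> W" "w \<noteq> w'" for w w'
  proof (rule ccontr)
    assume ne: "P.orb (z w) \<inter> P.orb (z w') \<noteq> {}"
    have wG: "w \<in> carrier G" "w' \<in> carrier G" using w assms(5) by auto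
    obtain g where g: "g \<in> carrier G" "act2 (z w) g = z w'"
      using P.orbs_meet[OF z[OF wG(1)] z[OF wG(2)] ne] by blast
    then have gK: "g \<in> K" and Hw: "act (act H w) g = act H w'"
      using stab_C[OF assms(4)] unfolding C.stab_def by (auto simp: act2_def z_def)
    have "double_coset G H w K = act H w <#>\<^bsub>G\<^esub> K" for w
      by (simp add: double_coset_def act_def r_coset_eq_set_mult)
    then have "double_coset G H w' K = act H w <#>\<^bsub>G\<^esub> (g <#\<^bsub>G\<^esub> K)"
      using Hw[symmetric] C.act_closed[OF HK(1) wG(1)] g(1) HK(2)
      by (simp add: act_def rcos_assoc_lcos)
    also have "g <#\<^bsub>G\<^esub> K = K" using coset_join3[OF g(1) assms(4) gK] .
    finally have "double_coset G H w' K = double_coset G H w K"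
      by (simp add: double_coset_def act_def r_coset_eq_set_mult)
    then show False
      using assms(6) w unfolding bij_betw_def by (metis (no_types, lifting) inj_onD)
  qed
  have "(\<Sum>w\<in>F. rrk G (conj_sub G H w \<inter> K)) \<le> 2 * rrk G H * rrk G K" if F: "finite F" "F \<subseteq> W" for F
  proof (rule enat_le_by_nats)
    fix m assume "enat m \<le> (\<Sum>w\<in>F. rrk G (conj_sub G H w \<inter> K))"
    moreover have FG: "F \<subseteq> carrier G" using F(2) assms(5) by auto
    ultimately have le: "enat m \<le> (\<Sum>w\<in>F. rrk G (P.stab (z w)))"
      using stab_z by (simp add: subset_iff cong: sum.cong)
    have zF: "z ` F \<subseteq> ?\<Omega> \<times> ?\<Omega>" by (rule image_subsetI) (rule z, rule subsetD[OF FG])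
    have "P.orb (z w) \<inter> P.orb (z w') = {}" if "w \<in> F" "w' \<in> F" "w \<noteq> w'" for w w'
      using disj that F(2) by (simp add: subset_iff)
    from P.sum_rrk_stab_subgraph[OF F(1) zF this le] obtain E0 where E0: "finite E0" "E0 \<subseteq> (\<Union>w\<in>F. P.orb (z w)) \<times> A"
        "card (verts act2 E0) + m \<le> card E0"
      by blast
    have E0\<Omega>: "E0 \<subseteq> (?\<Omega> \<times> ?\<Omega>) \<times> A"
    proof -
      have "(\<Union>w\<in>F. P.orb (z w)) \<subseteq> ?\<Omega> \<times> ?\<Omega>"
        using P.orb_subset zF by (simp add: UN_subset_iff image_subset_iff)
      then show ?thesis using E0(2) by (meson Sigma_mono order_refl order_trans)
    qed
    \<comment> \<open>Pruning keeps the surplus \<open>m\<close> and supplies the degree condition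
      of \<open>product_graph_bound\<close>.\<close>
    obtain E where E: "E \<subseteq> E0" "card (verts act2 E) + m \<le> card E"
        "\<forall>v\<in>verts act2 E. 2 \<le> card (link act2 E v)"
      using prune_leaves[OF E0(1) P.codet_act[OF E0\<Omega>] E0(3)] by blast
    have finE: "finite E" using E(1) E0(1) finite_subset by blast
    define E1 where "E1 = map_prod fst id ` E"
    define E2 where "E2 = map_prod snd id ` E"
    \<comment> \<open>Whatever \<open>w\<close> is, a vertex \<open>(Hwg, Kg)\<close> projects to
      the orbits of \<open>H\<close> and \<open>K\<close>. All double cosets thus share the same two
      projected graphs, and one product bounds the whole sum.\<close>
    have "fst p \<in> C.orb H \<and> snd p \<in> C.orb K" if p: "w \<in> F" "p \<in> P.orb (z w)" for w p
    proof -
      have w: "w \<in> carrier G" using p(1) FG by auto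
      obtain g where g: "g \<in> carrier G" "p = act2 (z w) g" using p(2) unfolding P.orb_def by auto
      then have "fst p = act H (w \<otimes>\<^bsub>G\<^esub> g)" "snd p = act K g"
        using w HK by (simp_all add: act2_def z_def C.act_mult)
      then show ?thesis using w g(1) unfolding C.orb_def by auto
    qed
    then have E12: "E1 \<subseteq> C.orb H \<times> A" "E2 \<subseteq> C.orb K \<times> A"
      using E(1) E0(2) by (fastforce simp: E1_def E2_def)+
    have fin12: "finite E1" "finite E2" using finE by (simp_all add: E1_def E2_def)
    have det: "codet act E1" "codet act E2"
      using E12 C.orb_subset[OF HK(1)] C.orb_subset[OF HK(2)] by (intro C.codet_act; blast)+
    have det2: "codet act2 E" using E(1) E0\<Omega> by (intro P.codet_act) (rule order_trans)
    have "card E - card (verts act2 E) \<le>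
        2 * (card E1 - card (verts act E1)) * (card E2 - card (verts act E2))"
      unfolding E1_def E2_def act2_def
      by (rule product_graph_bound) (use finE det det2 E(3) in \<open>simp_all add: E1_def E2_def act2_def\<close>)
    then have "m \<le> 2 * (card E1 - card (verts act E1)) * (card E2 - card (verts act E2))"
      using E(2) by simp
    then have "enat m \<le> 2 * enat (card E1 - card (verts act E1)) * enat (card E2 - card (verts act E2))"
      by (simp add: numeral_eq_enat)
    also have "\<dots> \<le> 2 * rrk G H * rrk G K"
      using C.subgraph_le_rrk[OF HK(1) fin12(1) E12(1)] C.subgraph_le_rrk[OF HK(2) fin12(2) E12(2)]
        stab_C assms(3,4) by (intro mult_mono) simp_all
    finally show "enat m \<le> 2 * rrk G H * rrk G K" .
  qed
  then show ?thesis unfolding esum_def by (intro SUP_least) simp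
qed

end
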